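(* Let $I\subset T_n$ be a nonzero monomial ideal which is a complete intersection, with $\deg(I)=d$. Then $I^{\sigma^t}\subset T_{td}$ is a complete intersection for every integer $t\ge n$.
   Context: $K$ is a field, $T=K[x_1,x_2,\ldots]$ and $T_n=K[x_1,\ldots,x_n]$. For a monomial $u=x_{i_1}\cdots x_{i_d}$ with $i_1\le\cdots\le i_d$, set $\sigma(u):=x_{i_1}x_{i_2+1}\cdots x_{i_d+d-1}$, and $\sigma^t(u):=\sigma(\sigma^{t-1}(u))$, so $\sigma^t(u)=x_{i_1}x_{i_2+t}\cdots x_{i_d+(d-1)t}$. For a nonzero monomial ideal $I$, $G(I)$ is its set of minimal monomial generators and $\deg(I)$ is the maximal degree of an element of $G(I)$. $I^\sigma$ is the ideal generated by $\sigma(u)$, $u\in G(I)$, for which $G(I^\sigma)=\{\sigma(u):u\in G(I)\}$; $I^{\sigma^t}:=(I^{\sigma^{t-1}})^\sigma$, so $I^{\sigma^t}$ is generated by $\sigma^t(u)$, $u\in G(I)$. For $t\ge n$ and $I\subset T_n$ with $\deg(I)=d$, $I^{\sigma^t}$ is considered as an ideal of $T_{td}$. A monomial ideal is a complete intersection if and only if its minimal monomial generators are pairwise coprime. *)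

theory Defs
  imports "HOL-Library.Poly_Mapping" "HOL-Algebra.Ideal"
begin

text \<open>
  A monomial is its exponent function, so products of monomials are sums here; \<open>single i 1\<close> is
  the variable \<open>x_i\<close>, with \<open>i \<ge> 1\<close>. (The order \<open>\<le>\<close> that Poly_Mapping puts on this type is
  lexicographic, not divisibility.)
\<close>

type_synonym mon = "nat \<Rightarrow>\<^sub>0 nat"
type_synonym 'k mpol = "mon \<Rightarrow>\<^sub>0 'k"

abbreviation mono_poly :: "mon \<Rightarrow> 'k::field mpol" where
  "mono_poly u \<equiv> Poly_Mapping.single u 1"

definition T :: "nat \<Rightarrow> 'k::field mpol ring" where
  "T n = \<lparr>carrier = {p. \<forall>m \<in> Poly_Mapping.keys p. Poly_Mapping.keys m \<subseteq> {1..n}},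
          mult = (*), one = 1, zero = 0, add = (+)\<rparr>"

definition mdvd :: "mon \<Rightarrow> mon \<Rightarrow> bool" where
  "mdvd u v \<longleftrightarrow> (\<exists>w. v = u + w)"

definition mdeg :: "mon \<Rightarrow> nat" where
  "mdeg u = (\<Sum>i\<in>Poly_Mapping.keys u. Poly_Mapping.lookup u i)"

definition monomial_ideal :: "nat \<Rightarrow> 'k::field mpol set \<Rightarrow> bool" where
  "monomial_ideal n I \<longleftrightarrow>
     (\<exists>S. (mono_poly ` S :: 'k mpol set) \<subseteq> carrier (T n) \<and> I = Idl\<^bsub>T n\<^esub> (mono_poly ` S))"

text \<open>
  The minimal monomial generators of a monomial ideal are the monomials of the ideal that are
  minimal for divisibility. They do not depend on the \<open>T n\<close> in which the ideal is considered.
\<close>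

definition mingens :: "'k::field mpol set \<Rightarrow> mon set" where
  "mingens I = {u. mono_poly u \<in> I \<and> (\<forall>v. mono_poly v \<in> I \<and> mdvd v u \<longrightarrow> v = u)}"

definition ideal_deg :: "'k::field mpol set \<Rightarrow> nat" where
  "ideal_deg I = Max (mdeg ` mingens I)"

text \<open>
  \<open>indices u\<close> is the list \<open>[i_1, \<dots>, i_d]\<close> with \<open>i_1 \<le> \<dots> \<le> i_d\<close> and \<open>u = x_{i_1} \<cdots> x_{i_d}\<close>.
  List positions count from 0, hence \<open>x_{i_j + (j-1)}\<close> is at position \<open>j - 1\<close> below.
\<close>

definition indices :: "mon \<Rightarrow> nat list" where
  "indices u = concat (map (\<lambda>i. replicate (Poly_Mapping.lookup u i) i)
     (sorted_list_of_set (Poly_Mapping.keys u)))"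

definition sigma :: "mon \<Rightarrow> mon" where
  "sigma u = (\<Sum>j<length (indices u). Poly_Mapping.single (indices u ! j + j) 1)"

text \<open>
  \<open>I\<^sup>\<sigma>\<close> and its iterates, as ideals of \<open>T m\<close>. The ring only matters for the ideal generated
  in the last step, as the minimal generators that each step starts from do not depend on it.
\<close>

definition sigma_ideal :: "nat \<Rightarrow> 'k::field mpol set \<Rightarrow> 'k mpol set" where
  "sigma_ideal m I = Idl\<^bsub>T m\<^esub> (mono_poly ` sigma ` mingens I)"

definition sigma_ideal_iter :: "nat \<Rightarrow> nat \<Rightarrow> 'k::field mpol set \<Rightarrow> 'k mpol set" where
  "sigma_ideal_iter m t I = (sigma_ideal m ^^ t) I"

text \<open>
  The ideal generated by all \<open>\<sigma>\<^sup>t(u)\<close> with \<open>u\<close> a minimal generator of \<open>I\<close>. The iterated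
  construction can give a smaller ideal, because \<open>\<sigma>\<close> may create divisibilities: for
  \<open>I = (x_3, x_1 x_2)\<close> one has \<open>I\<^sup>\<sigma> = (x_3, x_1 x_3) = (x_3)\<close>, so every iterate is
  \<open>(x_3)\<close>, whereas \<open>\<sigma>\<^sup>3\<close> sends the two generators to \<open>x_3\<close> and \<open>x_1 x_5\<close>.
\<close>

definition sigma_pow_ideal :: "nat \<Rightarrow> nat \<Rightarrow> 'k::field mpol set \<Rightarrow> 'k mpol set" where
  "sigma_pow_ideal m t I = Idl\<^bsub>T m\<^esub> (mono_poly ` (sigma ^^ t) ` mingens I)"

text \<open>
  A weakly regular sequence is one in which each term is a nonzerodivisor modulo the previous
  ones; it is regular iff moreover it generates a proper ideal. Hence for proper ideals,
  \<open>complete_intersection\<close> says that the ideal is generated by a regular sequence. Dropping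
  properness makes the unit ideal a complete intersection, in accordance with the criterion that a
  monomial ideal is a complete intersection iff its minimal monomial generators are pairwise
  coprime.
\<close>

definition weakly_regular :: "('a, 'b) ring_scheme \<Rightarrow> 'a list \<Rightarrow> bool" where
  "weakly_regular R fs \<longleftrightarrow> set fs \<subseteq> carrier R \<and>
     (\<forall>i<length fs. \<forall>g\<in>carrier R.
        g \<otimes>\<^bsub>R\<^esub> (fs ! i) \<in> Idl\<^bsub>R\<^esub> (set (take i fs)) \<longrightarrow> g \<in> Idl\<^bsub>R\<^esub> (set (take i fs)))"

definition complete_intersection :: "('a, 'b) ring_scheme \<Rightarrow> 'a set \<Rightarrow> bool" where
  "complete_intersection R I \<longleftrightarrow> (\<exists>fs. weakly_regular R fs \<and> I = Idl\<^bsub>R\<^esub> (set fs))"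

lemma cring_T: "cring (T n :: 'k::field mpol ring)"
proof -
  let ?P = "\<lambda>p :: 'k mpol. \<forall>m\<in>Poly_Mapping.keys p. Poly_Mapping.keys m \<subseteq> {1..n}"
  have ad: "?P (p + q)" if "?P p" "?P q" for p q
    using that Poly_Mapping.keys_add[of p q] by blast
  have mu: "?P (p * q)" if "?P p" "?P q" for p q
  proof
    fix m assume "m \<in> Poly_Mapping.keys (p * q)"
    then obtain a b where "m = a + b" "a \<in> Poly_Mapping.keys p" "b \<in> Poly_Mapping.keys q"
      using Poly_Mapping.keys_mult[of p q] by blast
    then show "Poly_Mapping.keys m \<subseteq> {1..n}"
      using that Poly_Mapping.keys_add[of a b] by blast
  qed
  have carr: "p \<in> carrier (T n) \<longleftrightarrow> ?P p" for p :: "'k mpol"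
    by (simp add: T_def)
  have ops: "x \<otimes>\<^bsub>T n\<^esub> y = x * y" "x \<oplus>\<^bsub>T n\<^esub> y = x + y" "\<one>\<^bsub>T n\<^esub> = 1" "\<zero>\<^bsub>T n\<^esub> = 0"
    for x y :: "'k mpol"
    by (simp_all add: T_def)
  show ?thesis
  proof (rule cringI)
    show "abelian_group (T n :: 'k mpol ring)"
    proof (rule abelian_groupI)
      fix x :: "'k mpol" assume "x \<in> carrier (T n)"
      then have "- x \<in> carrier (T n)" by (simp add: carr)
      then show "\<exists>y\<in>carrier (T n). y \<oplus>\<^bsub>T n\<^esub> x = \<zero>\<^bsub>T n\<^esub>"
        by (intro bexI[of _ "- x"]) (simp_all only: ops ab_left_minus)
    next
      fix x y :: "'k mpol" assume "x \<in> carrier (T n)" "y \<in> carrier (T n)"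
      then show "x \<oplus>\<^bsub>T n\<^esub> y \<in> carrier (T n)" unfolding carr ops by (rule ad)
    next
      show "\<zero>\<^bsub>T n\<^esub> \<in> carrier (T n :: 'k mpol ring)" unfolding carr ops by simp
    qed (simp_all only: ops ac_simps add_0_left add_0_right)
    show "comm_monoid (T n :: 'k mpol ring)"
    proof (rule comm_monoidI)
      fix x y :: "'k mpol" assume "x \<in> carrier (T n)" "y \<in> carrier (T n)"
      then show "x \<otimes>\<^bsub>T n\<^esub> y \<in> carrier (T n)" unfolding carr ops by (rule mu)
    next
      show "\<one>\<^bsub>T n\<^esub> \<in> carrier (T n :: 'k mpol ring)" unfolding carr ops by simp
    qed (simp_all only: ops ac_simps mult_1_left mult_1_right)
  qed (simp only: ops distrib_right)
qed

lemma sorted_indices: "sorted (indices u)"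
proof -
  have "sorted (concat (map (\<lambda>i. replicate (f i) i) xs))" if "sorted xs" for f and xs :: "nat list"
    using that by (induction xs) (auto simp: sorted_append)
  then show ?thesis by (simp add: indices_def)
qed

lemma sum_indices: "(\<Sum>i\<leftarrow>indices u. Poly_Mapping.single i 1) = u"
proof -
  have "(\<Sum>i\<leftarrow>concat (map (\<lambda>i. replicate (f i) i) xs). Poly_Mapping.single i (1::nat)) =
        (\<Sum>i\<leftarrow>xs. Poly_Mapping.single i (f i))" for f and xs :: "nat list"
  proof (induction xs)
    case (Cons a xs)
    have "(\<Sum>i\<leftarrow>replicate k a. Poly_Mapping.single i (1::nat)) = Poly_Mapping.single a k" for k
      by (induction k) (auto simp: single_add[symmetric])
    with Cons show ?case by simp
  qed simp
  then have "(\<Sum>i\<leftarrow>indices u. Poly_Mapping.single i 1) =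
        (\<Sum>i\<in>Poly_Mapping.keys u. Poly_Mapping.single i (Poly_Mapping.lookup u i))"
    by (simp add: indices_def sum_list_distinct_conv_sum_set)
  also have "\<dots> = u"
    by (rule poly_mapping_eqI)
       (auto simp: lookup_sum lookup_single when_def in_keys_iff sum.delta)
  finally show ?thesis .
qed

end

theory Submission
  imports Defs "HOL-Library.Multiset"
begin

text \<open>
  The minimal generators of \<open>I\<close> are pairwise coprime (\<open>mingens_coprime\<close>), and \<open>\<sigma>\<^sup>t\<close> keeps them
  so. Indeed, write \<open>u = x_{i_1} \<cdots> x_{i_e}\<close> with \<open>i_1 \<le> \<dots> \<le> i_e\<close>; the \<open>j\<close>-th factor of \<open>\<sigma>\<^sup>t(u)\<close> has
  index \<open>i_j + (j - 1) t\<close>, and for \<open>i_j \<le> n \<le> t\<close> this lies in the \<open>j\<close>-th block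
  \<open>{(j - 1) t + 1, \<dots>, j t}\<close>. The blocks are disjoint, so a variable common to \<open>\<sigma>\<^sup>t(u)\<close> and \<open>\<sigma>\<^sup>t(v)\<close>
  sits at the same position \<open>j\<close> in both and comes from a variable common to \<open>u\<close> and \<open>v\<close>
  (\<open>sigma_pow_coprime\<close>). Since \<open>e \<le> d\<close>, only the first \<open>d\<close> blocks occur, whence the ring in \<open>t d\<close>
  variables. Pairwise coprime monomials in turn form a weakly regular sequence
  (\<open>weakly_regular_coprime_monomials\<close>). The iterated ideal needs no separate argument: its
  minimal generators at each stage are among the \<open>\<sigma>\<^sup>k(u)\<close> (\<open>mingens_sigma_ideal_iter_subset\<close>), so the
  ideal at the last stage is generated by some of the pairwise coprime monomials \<open>\<sigma>\<^sup>t(u)\<close>.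

  The substance is in \<open>mingens_coprime\<close>: the given regular sequence \<open>f_1, \<dots>, f_r\<close> consists of
  arbitrary polynomials, unrelated to the monomials of \<open>I\<close>. Conceptually, \<open>I/I\<^sup>2\<close> is free over the
  quotient by \<open>I\<close>, so that every syzygy of a minimal generating set has its coefficients in \<open>I\<close>;
  applied to the syzygy \<open>b u - a v = 0\<close> with \<open>a = u / gcd(u, v)\<close> and \<open>b = v / gcd(u, v)\<close>, this gives
  \<open>b \<in> I\<close>, and by minimality of \<open>v\<close> the gcd is \<open>1\<close>. The proof below does this by hand for
  the one syzygy. With \<open>u = \<Sum> B_l f_l\<close> and \<open>v = \<Sum> C_l f_l\<close>, the relation
  \<open>\<Sum> (b B_l - a C_l) f_l = 0\<close> has coefficients in \<open>I\<close> (\<open>weakly_regular_relation\<close>). Write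
  \<open>f_l = A_l u + R_l\<close> with no monomial of \<open>R_l\<close> divisible by \<open>u\<close>. Then \<open>P = \<Sum> A_l B_l\<close> has constant
  term \<open>1\<close>, because \<open>u\<close> is minimal, and \<open>b P - a Q \<in> I\<close> for \<open>Q = \<Sum> A_l C_l\<close>. As \<open>a\<close> does not divide
  \<open>b\<close>, the monomial \<open>b\<close> occurs in \<open>b P - a Q\<close> with coefficient \<open>1\<close>, and \<open>b \<in> I\<close> because \<open>I\<close> is
  a monomial ideal.
\<close>

section \<open>Divisibility of monomials\<close>

lemma mdvd_iff_lookup:
  "mdvd u v \<longleftrightarrow> (\<forall>i. Poly_Mapping.lookup u i \<le> Poly_Mapping.lookup v i)"
proof
  assume "\<forall>i. Poly_Mapping.lookup u i \<le> Poly_Mapping.lookup v i"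
  then have "v = u + (v - u)"
    by (intro poly_mapping_eqI) (simp add: lookup_add lookup_minus)
  then show "mdvd u v" unfolding mdvd_def by blast
qed (auto simp: mdvd_def lookup_add)

lemma mdvd_refl: "mdvd u u"
  by (simp add: mdvd_iff_lookup)

lemma mdvd_add_left: "mdvd u v \<Longrightarrow> mdvd u (w + v)"
  by (simp add: mdvd_iff_lookup lookup_add trans_le_add2)

lemma keys_mdvd_subset: "mdvd u v \<Longrightarrow> Poly_Mapping.keys u \<subseteq> Poly_Mapping.keys v"
  by (auto simp: mdvd_iff_lookup in_keys_iff) (meson less_le_trans)

lemma mdvd_add_coprime:
  assumes "mdvd u (m + v)" and "Poly_Mapping.keys u \<inter> Poly_Mapping.keys v = {}"
  shows "mdvd u m"
  unfolding mdvd_iff_lookup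
proof
  fix i
  show "Poly_Mapping.lookup u i \<le> Poly_Mapping.lookup m i"
    using assms by (cases "i \<in> Poly_Mapping.keys u")
      (auto simp: mdvd_iff_lookup lookup_add in_keys_iff disjoint_iff dest: spec[of _ i])
qed

lemma mdvd_add_cancel_left: "mdvd (w + u) (w + v) \<longleftrightarrow> mdvd u v"
  by (simp add: mdvd_iff_lookup lookup_add)

section \<open>Ideals of the polynomial ring\<close>

lemma T_simps:
  "x \<otimes>\<^bsub>T n\<^esub> y = x * y" "x \<oplus>\<^bsub>T n\<^esub> y = x + y" "\<one>\<^bsub>T n\<^esub> = 1" "\<zero>\<^bsub>T n\<^esub> = 0"
  for x y :: "'k::field mpol"
  by (simp_all add: T_def)

lemma carrier_T_iff:
  "p \<in> carrier (T n) \<longleftrightarrow> (\<forall>m\<in>Poly_Mapping.keys p. Poly_Mapping.keys m \<subseteq> {1..n})"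
  by (simp add: T_def)

lemma mono_poly_carrier_iff:
  "(mono_poly u :: 'k::field mpol) \<in> carrier (T n) \<longleftrightarrow> Poly_Mapping.keys u \<subseteq> {1..n}"
  by (simp add: carrier_T_iff)

lemma ring_T: "ring (T n :: 'k::field mpol ring)"
  using cring_T by (rule cring.axioms(1))

lemma carrier_T_add: "p \<in> carrier (T n) \<Longrightarrow> q \<in> carrier (T n) \<Longrightarrow> p + q \<in> carrier (T n)"
  for p q :: "'k::field mpol"
  using ring.ring_simprules(1)[OF ring_T, of p n q] by (simp only: T_simps)

lemma carrier_T_mult: "p \<in> carrier (T n) \<Longrightarrow> q \<in> carrier (T n) \<Longrightarrow> p * q \<in> carrier (T n)"
  for p q :: "'k::field mpol"
  using ring.ring_simprules(5)[OF ring_T, of p n q] by (simp only: T_simps)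

lemma carrier_T_uminus: "p \<in> carrier (T n) \<Longrightarrow> - p \<in> carrier (T n)"
  for p :: "'k::field mpol"
  by (simp add: carrier_T_iff in_keys_iff)

lemma carrier_T_diff: "p \<in> carrier (T n) \<Longrightarrow> q \<in> carrier (T n) \<Longrightarrow> p - q \<in> carrier (T n)"
  for p q :: "'k::field mpol"
  using carrier_T_add[OF _ carrier_T_uminus] by fastforce

lemma carrier_T_0: "(0 :: 'k::field mpol) \<in> carrier (T n)"
  by (simp add: carrier_T_iff)

lemma carrier_T_1: "(1 :: 'k::field mpol) \<in> carrier (T n)"
  by (simp add: carrier_T_iff)

lemma carrier_T_sum:
  "(\<And>x. x \<in> A \<Longrightarrow> f x \<in> carrier (T n)) \<Longrightarrow> (sum f A :: 'k::field mpol) \<in> carrier (T n)"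
  by (induction A rule: infinite_finite_induct) (auto intro: carrier_T_0 carrier_T_add)

text \<open>
  \<open>ideal_TI\<close> and the rules after it turn ideal membership into statements about the type class
  operations on polynomials, away from the ring record.
\<close>

lemma ideal_TI:
  fixes J :: "'k::field mpol set"
  assumes sub: "J \<subseteq> carrier (T n)" and zero: "0 \<in> J"
    and add: "\<And>x y. x \<in> J \<Longrightarrow> y \<in> J \<Longrightarrow> x + y \<in> J"
    and mult: "\<And>a x. a \<in> carrier (T n) \<Longrightarrow> x \<in> J \<Longrightarrow> a * x \<in> J"
  shows "ideal J (T n)"
proof (rule idealI[OF ring_T])
  interpret ring "T n :: 'k mpol ring" by (rule ring_T)
  have inv: "\<ominus>\<^bsub>T n\<^esub> x = - x" if "x \<in> J" for x
    using that sub carrier_T_uminus[of x n] by (intro minus_equality) (auto simp: T_simps)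
  have "- x \<in> J" if "x \<in> J" for x
    using mult[OF carrier_T_uminus[OF carrier_T_1] that] by simp
  with inv show "subgroup J (add_monoid (T n))"
    using sub zero add
    by (intro group.subgroupI[OF a_group]) (auto simp: T_simps a_inv_def)
next
  fix a x :: "'k mpol" assume "a \<in> J" "x \<in> carrier (T n)"
  then have "x * a \<in> J" by (intro mult)
  then show "x \<otimes>\<^bsub>T n\<^esub> a \<in> J" "a \<otimes>\<^bsub>T n\<^esub> x \<in> J"
    by (simp_all only: T_simps mult.commute[of a x])
qed

lemma
  fixes J :: "'k::field mpol set"
  assumes "ideal J (T n)"
  shows ideal_T_carrier: "x \<in> J \<Longrightarrow> x \<in> carrier (T n)"
    and ideal_T_0: "0 \<in> J"
    and ideal_T_add: "x \<in> J \<Longrightarrow> y \<in> J \<Longrightarrow> x + y \<in> J"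
    and ideal_T_mult: "a \<in> carrier (T n) \<Longrightarrow> x \<in> J \<Longrightarrow> a * x \<in> J"
proof -
  interpret ideal J "T n" by fact
  show "x \<in> J \<Longrightarrow> x \<in> carrier (T n)" by (rule Icarr)
  show "0 \<in> J" using additive_subgroup.zero_closed[OF is_additive_subgroup] by (simp add: T_simps)
  show "x \<in> J \<Longrightarrow> y \<in> J \<Longrightarrow> x + y \<in> J"
    using additive_subgroup.a_closed[OF is_additive_subgroup, of x y] by (simp add: T_simps)
  show "a \<in> carrier (T n) \<Longrightarrow> x \<in> J \<Longrightarrow> a * x \<in> J"
    using I_l_closed[of x a] by (simp add: T_simps)
qed

lemma ideal_T_diff:
  fixes x y :: "'k::field mpol"
  assumes "ideal J (T n)" "x \<in> J" "y \<in> J"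
  shows "x - y \<in> J"
proof -
  have "- 1 * y \<in> J"
    using assms(1) carrier_T_uminus[OF carrier_T_1] assms(3) by (rule ideal_T_mult)
  with assms have "x + - 1 * y \<in> J" by (intro ideal_T_add)
  then show ?thesis by simp
qed

lemma ideal_T_sum:
  "ideal J (T n) \<Longrightarrow> (\<And>x. x \<in> A \<Longrightarrow> f x \<in> J) \<Longrightarrow> (sum f A :: 'k::field mpol) \<in> J"
  by (induction A rule: infinite_finite_induct) (auto intro: ideal_T_0 ideal_T_add)

lemma ideal_T_Idl: "X \<subseteq> carrier (T n) \<Longrightarrow> ideal (Idl\<^bsub>T n\<^esub> X) (T n :: 'k::field mpol ring)"
  by (rule ring.genideal_ideal[OF ring_T])

lemma sum_monomials:
  "(\<Sum>m\<in>Poly_Mapping.keys p. Poly_Mapping.single m (Poly_Mapping.lookup p m)) = p"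
  by (rule poly_mapping_eqI)
     (auto simp: lookup_sum lookup_single when_def in_keys_iff sum.delta)

lemma lookup_mult_mono_poly:
  fixes p :: "'k::field mpol"
  shows "Poly_Mapping.lookup (p * mono_poly u) (m + u) = Poly_Mapping.lookup p m"
proof -
  have "p * mono_poly u
      = (\<Sum>k\<in>Poly_Mapping.keys p. Poly_Mapping.single (k + u) (Poly_Mapping.lookup p k))"
    by (subst sum_monomials[symmetric]) (simp add: sum_distrib_right mult_single)
  then show ?thesis
    by (auto simp: lookup_sum lookup_single when_def in_keys_iff sum.delta)
qed

lemma lookup_mult_mono_poly_not_mdvd:
  fixes p :: "'k::field mpol"
  assumes "\<not> mdvd u m"
  shows "Poly_Mapping.lookup (p * mono_poly u) m = 0"
proof (rule ccontr)
  assume "\<not> ?thesis"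
  then have "m \<in> Poly_Mapping.keys (p * mono_poly u)" by (simp add: in_keys_iff)
  then show False
    using keys_mult[of p "mono_poly u :: 'k mpol"] assms by (auto simp: mdvd_def add.commute)
qed

lemma mem_Idl_monomials_iff:
  fixes p :: "'k::field mpol"
  assumes S: "(mono_poly ` S :: 'k mpol set) \<subseteq> carrier (T n)"
  shows "p \<in> Idl\<^bsub>T n\<^esub> (mono_poly ` S) \<longleftrightarrow>
         p \<in> carrier (T n) \<and> (\<forall>m\<in>Poly_Mapping.keys p. \<exists>s\<in>S. mdvd s m)"
    (is "_ \<longleftrightarrow> ?R p")
proof
  have "ideal (Collect ?R) (T n)"
  proof (rule ideal_TI)
    show "x + y \<in> Collect ?R" if "x \<in> Collect ?R" "y \<in> Collect ?R" for x y
      using that keys_add[of x y] carrier_T_add[of x n y] by blast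
    show "a * x \<in> Collect ?R" if "a \<in> carrier (T n)" "x \<in> Collect ?R" for a x
    proof -
      have "\<exists>s\<in>S. mdvd s m" if m: "m \<in> Poly_Mapping.keys (a * x)" for m
      proof -
        obtain i j where "m = i + j" "j \<in> Poly_Mapping.keys x"
          using m keys_mult[of a x] by blast
        then show ?thesis using \<open>x \<in> Collect ?R\<close> mdvd_add_left by blast
      qed
      then show ?thesis using that carrier_T_mult by blast
    qed
  qed (auto intro: carrier_T_0)
  moreover have "mono_poly ` S \<subseteq> Collect ?R"
  proof
    fix p :: "'k mpol" assume "p \<in> mono_poly ` S"
    then obtain s where "s \<in> S" "p = mono_poly s" by blast
    moreover have "\<exists>s'\<in>S. mdvd s' s" using \<open>s \<in> S\<close> mdvd_refl by blast
    ultimately show "p \<in> Collect ?R" using S by auto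
  qed
  ultimately show "p \<in> Idl\<^bsub>T n\<^esub> (mono_poly ` S) \<Longrightarrow> ?R p"
    using ring.genideal_minimal[OF ring_T, of "Collect ?R" n "mono_poly ` S"] by blast
next
  assume p: "?R p"
  note I = ideal_T_Idl[OF S]
  have "Poly_Mapping.single m (Poly_Mapping.lookup p m) \<in> Idl\<^bsub>T n\<^esub> (mono_poly ` S)"
    if m: "m \<in> Poly_Mapping.keys p" for m
  proof -
    obtain s w where s: "s \<in> S" and w: "m = s + w"
      using p m by (auto simp: mdvd_def)
    have "Poly_Mapping.keys w \<subseteq> {1..n}"
      using p m keys_mdvd_subset[of w m] w by (auto simp: carrier_T_iff mdvd_def add.commute)
    then have "Poly_Mapping.single w (Poly_Mapping.lookup p m) \<in> carrier (T n)"
      by (auto simp: carrier_T_iff in_keys_iff lookup_single when_def split: if_splits)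
    moreover have "(mono_poly s :: 'k mpol) \<in> Idl\<^bsub>T n\<^esub> (mono_poly ` S)"
      using ring.genideal_self[OF ring_T S] s by blast
    ultimately have "Poly_Mapping.single w (Poly_Mapping.lookup p m) * mono_poly s
        \<in> Idl\<^bsub>T n\<^esub> (mono_poly ` S)"
      by (rule ideal_T_mult[OF I])
    then show ?thesis by (simp add: mult_single w add.commute)
  qed
  then have "(\<Sum>m\<in>Poly_Mapping.keys p. Poly_Mapping.single m (Poly_Mapping.lookup p m))
      \<in> Idl\<^bsub>T n\<^esub> (mono_poly ` S)"
    by (rule ideal_T_sum[OF I])
  then show "p \<in> Idl\<^bsub>T n\<^esub> (mono_poly ` S)"
    by (simp only: sum_monomials)
qed

section \<open>Minimal monomial generators\<close>

lemma ideal_monomial_ideal: "ideal I (T n)" if "monomial_ideal n I" for I :: "'k::field mpol set"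
  using that ideal_T_Idl by (auto simp: monomial_ideal_def)

text \<open>
  That a polynomial of a monomial ideal has all its monomials in the ideal is what lets a
  single coefficient be read off in \<open>mingens_coprime\<close>.
\<close>

lemma mem_monomial_ideal_iff:
  fixes I :: "'k::field mpol set"
  assumes "monomial_ideal n I"
  shows "p \<in> I \<longleftrightarrow> p \<in> carrier (T n) \<and> (\<forall>m\<in>Poly_Mapping.keys p. mono_poly m \<in> I)"
proof -
  obtain S where S: "(mono_poly ` S :: 'k mpol set) \<subseteq> carrier (T n)"
    and I: "I = Idl\<^bsub>T n\<^esub> (mono_poly ` S)"
    using assms by (auto simp: monomial_ideal_def)
  show ?thesis
    unfolding I mem_Idl_monomials_iff[OF S] by (auto simp: carrier_T_iff)
qed

lemma mingens_Idl_subset: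
  assumes "(mono_poly ` S :: 'k::field mpol set) \<subseteq> carrier (T n)"
  shows "mingens (Idl\<^bsub>T n\<^esub> (mono_poly ` S) :: 'k mpol set) \<subseteq> S"
proof
  fix u assume "u \<in> mingens (Idl\<^bsub>T n\<^esub> (mono_poly ` S) :: 'k mpol set)"
  then have u: "(mono_poly u :: 'k mpol) \<in> Idl\<^bsub>T n\<^esub> (mono_poly ` S)"
    and min: "\<And>v. (mono_poly v :: 'k mpol) \<in> Idl\<^bsub>T n\<^esub> (mono_poly ` S) \<Longrightarrow> mdvd v u \<Longrightarrow> v = u"
    by (auto simp: mingens_def)
  obtain s where s: "s \<in> S" "mdvd s u"
    using u unfolding mem_Idl_monomials_iff[OF assms] by auto
  then have "(mono_poly s :: 'k mpol) \<in> Idl\<^bsub>T n\<^esub> (mono_poly ` S)"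
    using ring.genideal_self[OF ring_T assms] by blast
  with min s show "u \<in> S" by blast
qed

section \<open>Regular sequences\<close>

lemma weakly_regular_append:
  "weakly_regular (T n) (fs @ [f]) \<longleftrightarrow> weakly_regular (T n) fs \<and> f \<in> carrier (T n) \<and>
     (\<forall>g\<in>carrier (T n). g * f \<in> Idl\<^bsub>T n\<^esub> (set fs) \<longrightarrow> g \<in> Idl\<^bsub>T n\<^esub> (set fs))"
  for fs :: "'k::field mpol list"
  by (auto simp: weakly_regular_def nth_append less_Suc_eq T_simps)

lemma mem_Idl_set_obtains_coefficients:
  fixes fs :: "'k::field mpol list"
  assumes "set fs \<subseteq> carrier (T n)" and "p \<in> Idl\<^bsub>T n\<^esub> (set fs)"
  obtains q where "\<And>l. q l \<in> carrier (T n)" "p = (\<Sum>l<length fs. q l * fs ! l)"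
proof -
  let ?J = "{p. \<exists>q. (\<forall>l. q l \<in> carrier (T n)) \<and> p = (\<Sum>l<length fs. q l * fs ! l)}"
  have "ideal ?J (T n)"
  proof (rule ideal_TI)
    show "?J \<subseteq> carrier (T n)"
      using assms(1) by (auto intro!: carrier_T_sum carrier_T_mult)
    show "0 \<in> ?J"
      by (auto intro!: exI[of _ "\<lambda>_. 0"] carrier_T_0)
    fix x y assume "x \<in> ?J" "y \<in> ?J"
    then obtain q r where "\<forall>l. q l \<in> carrier (T n)" "x = (\<Sum>l<length fs. q l * fs ! l)"
      and "\<forall>l. r l \<in> carrier (T n)" "y = (\<Sum>l<length fs. r l * fs ! l)"
      by blast
    then show "x + y \<in> ?J"
      by (auto intro!: exI[of _ "\<lambda>l. q l + r l"] carrier_T_add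
          simp: sum.distrib distrib_right)
  next
    fix a x :: "'k mpol" assume a: "a \<in> carrier (T n)" and "x \<in> ?J"
    then obtain q where "\<forall>l. q l \<in> carrier (T n)" "x = (\<Sum>l<length fs. q l * fs ! l)"
      by blast
    with a show "a * x \<in> ?J"
      by (auto intro!: exI[of _ "\<lambda>l. a * q l"] carrier_T_mult
          simp: sum_distrib_left mult.assoc)
  qed
  moreover have "set fs \<subseteq> ?J"
  proof
    fix f assume "f \<in> set fs"
    then obtain i where i: "i < length fs" "f = fs ! i" by (metis in_set_conv_nth)
    have "(\<Sum>l<length fs. (if l = i then 1 else 0) * fs ! l) = fs ! i"
      using i by (simp add: if_distrib[of "\<lambda>c. c * _"] sum.delta cong: if_cong)
    with i show "f \<in> ?J"
      by (auto intro!: exI[of _ "\<lambda>l. if l = i then 1 else 0"] carrier_T_0 carrier_T_1)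
  qed
  ultimately have "Idl\<^bsub>T n\<^esub> (set fs) \<subseteq> ?J"
    by (rule ring.genideal_minimal[OF ring_T])
  with assms(2) that show thesis by blast
qed

text \<open>
  Modulo the earlier terms, a relation says that its last coefficient \<open>h_s\<close> annihilates the last
  term \<open>f\<close>, so by regularity \<open>h_s = \<Sum> q_l f_l\<close> with the sum over the earlier terms. Substituting
  this gives the shorter relation \<open>\<Sum> (h_l + q_l f) f_l = 0\<close>, to which induction applies; subtracting
  \<open>q_l f\<close>, a multiple of the last term \<open>f\<close>, recovers \<open>h_l\<close>.
\<close>

lemma weakly_regular_relation:
  fixes fs :: "'k::field mpol list"
  assumes "weakly_regular (T n) fs"
    and "\<And>l. h l \<in> carrier (T n)" and "(\<Sum>l<length fs. h l * fs ! l) = 0"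
    and "l < length fs"
  shows "h l \<in> Idl\<^bsub>T n\<^esub> (set fs)"
  using assms
proof (induction fs arbitrary: h l rule: rev_induct)
  case (snoc f fs)
  have reg: "weakly_regular (T n) fs" and f: "f \<in> carrier (T n)"
    and last: "\<And>g. g \<in> carrier (T n) \<Longrightarrow> g * f \<in> Idl\<^bsub>T n\<^esub> (set fs) \<Longrightarrow> g \<in> Idl\<^bsub>T n\<^esub> (set fs)"
    using snoc.prems(1) by (auto simp: weakly_regular_append)
  have fs: "set fs \<subseteq> carrier (T n)" using reg by (simp add: weakly_regular_def)
  note J = ideal_T_Idl[OF fs]
  have fsf: "set (fs @ [f]) \<subseteq> carrier (T n)" using fs f by simp
  note J' = ideal_T_Idl[OF fsf]
  have mono: "Idl\<^bsub>T n\<^esub> (set fs) \<subseteq> Idl\<^bsub>T n\<^esub> (set (fs @ [f]))"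
    using ring.subset_Idl_subset[OF ring_T fsf] by auto
  define s where "s = length fs"
  have sum0: "(\<Sum>l<s. h l * fs ! l) + h s * f = 0"
    using snoc.prems(3) by (simp add: s_def nth_append)
  have "(\<Sum>l<s. h l * fs ! l) \<in> Idl\<^bsub>T n\<^esub> (set fs)"
    using snoc.prems(2) ring.genideal_self[OF ring_T fs]
    by (intro ideal_T_sum[OF J] ideal_T_mult[OF J]) (auto simp: s_def)
  then have "h s * f \<in> Idl\<^bsub>T n\<^esub> (set fs)"
    using ideal_T_diff[OF J ideal_T_0[OF J]] sum0 by (metis add_eq_0_iff diff_0)
  then have hs: "h s \<in> Idl\<^bsub>T n\<^esub> (set fs)" using last snoc.prems(2) by blast
  then obtain q where q: "\<And>l. q l \<in> carrier (T n)" and hq: "h s = (\<Sum>l<length fs. q l * fs ! l)"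
    using mem_Idl_set_obtains_coefficients[OF fs] by blast
  have "(\<Sum>l<length fs. (h l + q l * f) * fs ! l)
      = (\<Sum>l<length fs. h l * fs ! l) + (\<Sum>l<length fs. q l * fs ! l) * f"
    by (simp add: distrib_right sum.distrib sum_distrib_right mult.assoc mult.commute[of f])
  also have "\<dots> = 0"
    unfolding hq[symmetric] using sum0 by (simp only: s_def)
  finally have "(\<Sum>l<length fs. (h l + q l * f) * fs ! l) = 0" .
  then have IH: "h l + q l * f \<in> Idl\<^bsub>T n\<^esub> (set fs)" if "l < length fs" for l
    using that snoc.prems(2) q f
    by (intro snoc.IH[OF reg, of "\<lambda>l. h l + q l * f"] carrier_T_add carrier_T_mult)
  show ?case
  proof (cases "l = s")
    case False
    then have "l < length fs" using snoc.prems(4) by (simp add: s_def)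
    from IH[OF this] have "h l + q l * f \<in> Idl\<^bsub>T n\<^esub> (set (fs @ [f]))" using mono by blast
    moreover have "f \<in> Idl\<^bsub>T n\<^esub> (set (fs @ [f]))"
      using ring.genideal_self[OF ring_T fsf] by auto
    then have "q l * f \<in> Idl\<^bsub>T n\<^esub> (set (fs @ [f]))" by (rule ideal_T_mult[OF J' q])
    ultimately show ?thesis using ideal_T_diff[OF J', of "h l + q l * f" "q l * f"] by simp
  qed (use hs mono in auto)
qed simp

text \<open>
  If \<open>g u\<close> lies in an ideal generated by monomials coprime to \<open>u\<close>, then every monomial of \<open>g u\<close> is
  divisible by one of them, and by coprimality that generator already divides the monomial of
  \<open>g\<close>.
\<close>

lemma weakly_regular_coprime_monomials:
  assumes "distinct us" and "\<And>u. u \<in> set us \<Longrightarrow> Poly_Mapping.keys u \<subseteq> {1..n}"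
    and "pairwise (\<lambda>u v. Poly_Mapping.keys u \<inter> Poly_Mapping.keys v = {}) (set us)"
  shows "weakly_regular (T n) (map mono_poly us :: 'k::field mpol list)"
  using assms
proof (induction us rule: rev_induct)
  case (snoc u us)
  have us: "(mono_poly ` set us :: 'k mpol set) \<subseteq> carrier (T n)"
    using snoc.prems(2) by (auto simp: mono_poly_carrier_iff)
  have "g \<in> Idl\<^bsub>T n\<^esub> (mono_poly ` set us)"
    if g: "g \<in> carrier (T n)" and gu: "g * mono_poly u \<in> Idl\<^bsub>T n\<^esub> (mono_poly ` set us)"
    for g :: "'k mpol"
    unfolding mem_Idl_monomials_iff[OF us]
  proof (intro conjI ballI g)
    fix m assume "m \<in> Poly_Mapping.keys g"
    then have "m + u \<in> Poly_Mapping.keys (g * mono_poly u)"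
      by (simp add: in_keys_iff lookup_mult_mono_poly)
    then obtain s where s: "s \<in> set us" "mdvd s (m + u)"
      using gu unfolding mem_Idl_monomials_iff[OF us] by blast
    then have "Poly_Mapping.keys s \<inter> Poly_Mapping.keys u = {}"
      using snoc.prems(1,3) by (auto simp: pairwise_def)
    with s mdvd_add_coprime show "\<exists>s\<in>set us. mdvd s m" by blast
  qed
  moreover have "weakly_regular (T n) (map mono_poly us :: 'k mpol list)"
    using snoc.prems by (intro snoc.IH) (auto simp: pairwise_insert)
  ultimately show ?case
    using snoc.prems(2) by (simp add: weakly_regular_append mono_poly_carrier_iff)
qed (simp add: weakly_regular_def)

lemma complete_intersection_coprime_monomials:
  assumes "finite S" and "\<And>u. u \<in> S \<Longrightarrow> Poly_Mapping.keys u \<subseteq> {1..n}"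
    and "pairwise (\<lambda>u v. Poly_Mapping.keys u \<inter> Poly_Mapping.keys v = {}) S"
  shows "complete_intersection (T n) (Idl\<^bsub>T n\<^esub> (mono_poly ` S) :: 'k::field mpol set)"
proof -
  obtain us where us: "set us = S" "distinct us"
    using finite_distinct_list[OF assms(1)] by blast
  have "weakly_regular (T n) (map mono_poly us :: 'k mpol list)"
    using us assms by (intro weakly_regular_coprime_monomials) auto
  with us show ?thesis unfolding complete_intersection_def by (metis list.set_map)
qed

lemma split_off_multiples:
  fixes p :: "'k::field mpol"
  assumes "p \<in> carrier (T n)"
  obtains a r where "a \<in> carrier (T n)" "p = a * mono_poly u + r"
    "\<And>m. m \<in> Poly_Mapping.keys r \<Longrightarrow> m \<in> Poly_Mapping.keys p \<and> \<not> mdvd u m"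
proof -
  define D where "D = {m \<in> Poly_Mapping.keys p. mdvd u m}"
  let ?t = "\<lambda>m k. Poly_Mapping.single k (Poly_Mapping.lookup p m)"
  define a r where "a = (\<Sum>m\<in>D. ?t m (m - u))" and "r = (\<Sum>m\<in>Poly_Mapping.keys p - D. ?t m m)"
  have "m - u + u = m" if "m \<in> D" for m
    using that by (auto simp: D_def mdvd_def add.commute)
  then have "a * mono_poly u = (\<Sum>m\<in>D. ?t m m)"
    by (simp add: a_def sum_distrib_right mult_single cong: sum.cong)
  then have "p = a * mono_poly u + r"
    using sum.subset_diff[of D "Poly_Mapping.keys p" "\<lambda>m. ?t m m"] sum_monomials[of p]
    by (simp add: r_def D_def add.commute)
  moreover have "a \<in> carrier (T n)"
    unfolding a_def
  proof (rule carrier_T_sum)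
    fix m assume "m \<in> D"
    then have "m \<in> Poly_Mapping.keys p" and "mdvd (m - u) m"
      by (auto simp: D_def mdvd_def add.commute)
    then have "Poly_Mapping.keys (m - u) \<subseteq> {1..n}"
      using assms keys_mdvd_subset unfolding carrier_T_iff by blast
    then show "?t m (m - u) \<in> carrier (T n)"
      by (auto simp: carrier_T_iff in_keys_iff lookup_single when_def split: if_splits)
  qed
  moreover have "m \<in> Poly_Mapping.keys p \<and> \<not> mdvd u m" if "m \<in> Poly_Mapping.keys r" for m
    using that keys_sum[of "\<lambda>m. ?t m m" "Poly_Mapping.keys p - D"]
    by (auto simp: r_def D_def in_keys_iff lookup_sum lookup_single when_def split: if_splits)
  ultimately show thesis using that by blast
qed

text \<open>
  The regular sequence \<open>fs\<close> may consist of arbitrary polynomials, so regularity says nothing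
  about \<open>u\<close> and \<open>v\<close> directly. Their syzygy is rewritten as a relation between the \<open>fs\<close>, where
  regularity applies, and the outcome is brought back to monomials by comparing coefficients.
\<close>

lemma mingens_coprime:
  fixes I :: "'k::field mpol set"
  assumes mon: "monomial_ideal n I" and ci: "complete_intersection (T n) I"
    and u: "u \<in> mingens I" and v: "v \<in> mingens I" and "u \<noteq> v"
  shows "Poly_Mapping.keys u \<inter> Poly_Mapping.keys v = {}"
proof -
  obtain fs where reg: "weakly_regular (T n) fs" and I: "I = Idl\<^bsub>T n\<^esub> (set fs)"
    using ci by (auto simp: complete_intersection_def)
  have fs: "set fs \<subseteq> carrier (T n)" using reg by (simp add: weakly_regular_def)
  note id = ideal_monomial_ideal[OF mon]
  have uI: "(mono_poly u :: 'k mpol) \<in> I" and vI: "(mono_poly v :: 'k mpol) \<in> I"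
    and minu: "\<And>m. (mono_poly m :: 'k mpol) \<in> I \<Longrightarrow> mdvd m u \<Longrightarrow> m = u"
    and minv: "\<And>m. (mono_poly m :: 'k mpol) \<in> I \<Longrightarrow> mdvd m v \<Longrightarrow> m = v"
    using u v by (auto simp: mingens_def)
  \<comment> \<open>Truncated subtraction of exponents gives \<open>a = u / gcd(u, v)\<close> and \<open>b = v / gcd(u, v)\<close>, and
    hence \<open>w = gcd(u, v)\<close>.\<close>
  define a where "a = u - v"
  define b where "b = v - u"
  define w where "w = u - a"
  have u_eq: "u = w + a" and v_eq: "v = w + b"
    by (auto intro!: poly_mapping_eqI simp: a_def b_def w_def lookup_add lookup_minus)
  have bu: "b + u = a + v" unfolding u_eq v_eq by (simp add: ac_simps)
  have "\<not> mdvd a b"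
    using mdvd_add_cancel_left[of w a b] u_eq v_eq minv[OF uI] \<open>u \<noteq> v\<close> by auto
  have car: "(mono_poly a :: 'k mpol) \<in> carrier (T n)" "(mono_poly b :: 'k mpol) \<in> carrier (T n)"
    using ideal_T_carrier[OF id uI] ideal_T_carrier[OF id vI] keys_mdvd_subset[of a u]
      keys_mdvd_subset[of b v] mdvd_add_left[OF mdvd_refl] u_eq v_eq
    by (auto simp: mono_poly_carrier_iff)
  obtain B where B: "\<And>l. B l \<in> carrier (T n)" and uB: "mono_poly u = (\<Sum>l<length fs. B l * fs ! l)"
    using mem_Idl_set_obtains_coefficients[OF fs] uI unfolding I by metis
  obtain C where C: "\<And>l. C l \<in> carrier (T n)" and vC: "mono_poly v = (\<Sum>l<length fs. C l * fs ! l)"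
    using mem_Idl_set_obtains_coefficients[OF fs] vI unfolding I by metis
  define h where "h l = mono_poly b * B l - mono_poly a * C l" for l
  have "(\<Sum>l<length fs. h l * fs ! l) = mono_poly b * mono_poly u - mono_poly a * mono_poly v"
    unfolding h_def uB vC by (simp add: left_diff_distrib sum_subtractf sum_distrib_left mult.assoc)
  also have "\<dots> = 0" by (simp add: mult_single bu)
  finally have hI: "h l \<in> I" if "l < length fs" for l
    unfolding I using that car B C
    by (intro weakly_regular_relation[OF reg]) (auto simp: h_def intro!: carrier_T_diff carrier_T_mult)
  have fsI: "fs ! l \<in> I" if "l < length fs" for l
    unfolding I using ring.genideal_self[OF ring_T fs] that by auto
  \<comment> \<open>Back from the \<open>f_l\<close> to monomials: only the part of \<open>f_l\<close> divisible by \<open>u\<close> can contribute to the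
    coefficient of \<open>u\<close> in \<open>u = \<Sum> B_l f_l\<close>, since a monomial of \<open>I\<close> dividing \<open>u\<close> is \<open>u\<close> itself.\<close>
  have "\<exists>A R. A \<in> carrier (T n) \<and> fs ! l = A * mono_poly u + R \<and>
      (\<forall>m\<in>Poly_Mapping.keys R. m \<in> Poly_Mapping.keys (fs ! l) \<and> \<not> mdvd u m)"
    if "l < length fs" for l
    using split_off_multiples[OF ideal_T_carrier[OF id fsI[OF that]], of u] by metis
  then obtain A R where A: "\<And>l. l < length fs \<Longrightarrow> A l \<in> carrier (T n)"
    and fA: "\<And>l. l < length fs \<Longrightarrow> fs ! l = A l * mono_poly u + R l"
    and R: "\<And>l m. l < length fs \<Longrightarrow> m \<in> Poly_Mapping.keys (R l) \<Longrightarrow>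
      m \<in> Poly_Mapping.keys (fs ! l) \<and> \<not> mdvd u m"
    by metis
  define P where "P = (\<Sum>l<length fs. B l * A l)"
  define Q where "Q = (\<Sum>l<length fs. C l * A l)"
  have u_PR: "mono_poly u = P * mono_poly u + (\<Sum>l<length fs. B l * R l)"
    unfolding P_def
    by (subst uB) (simp add: fA distrib_left sum.distrib sum_distrib_right mult.assoc)
  have "Poly_Mapping.lookup (B l * R l) u = 0" if l: "l < length fs" for l
  proof (rule ccontr)
    assume "Poly_Mapping.lookup (B l * R l) u \<noteq> 0"
    then have "u \<in> Poly_Mapping.keys (B l * R l)" by (simp add: in_keys_iff)
    then obtain i j where ij: "u = i + j" "j \<in> Poly_Mapping.keys (R l)"
      using keys_mult[of "B l" "R l"] by blast
    then have "(mono_poly j :: 'k mpol) \<in> I"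
      using fsI[OF l] R[OF l] mem_monomial_ideal_iff[OF mon] by blast
    moreover have "mdvd j u" unfolding ij(1) by (rule mdvd_add_left[OF mdvd_refl])
    ultimately have "j = u" by (rule minu)
    with R[OF l ij(2)] mdvd_refl show False by blast
  qed
  then have "Poly_Mapping.lookup (mono_poly u :: 'k mpol) u = Poly_Mapping.lookup (P * mono_poly u) u"
    by (subst u_PR) (simp add: lookup_add lookup_sum)
  then have P0: "Poly_Mapping.lookup P 0 = 1"
    using lookup_mult_mono_poly[of P u 0] by simp
  have "(\<Sum>l<length fs. A l * h l) \<in> I"
    using A hI by (intro ideal_T_sum[OF id] ideal_T_mult[OF id]) auto
  moreover have "(\<Sum>l<length fs. A l * h l) = P * mono_poly b - Q * mono_poly a"
    unfolding P_def Q_def h_def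
    by (simp add: right_diff_distrib sum_subtractf sum_distrib_left sum_distrib_right mult.assoc
        mult.commute mult.left_commute)
  \<comment> \<open>\<open>b\<close> occurs in \<open>P b\<close> with the constant term of \<open>P\<close> as coefficient, and not at all in \<open>Q a\<close>.\<close>
  moreover have "Poly_Mapping.lookup (P * mono_poly b - Q * mono_poly a) b = 1"
    using lookup_mult_mono_poly[of P b 0] lookup_mult_mono_poly_not_mdvd[OF \<open>\<not> mdvd a b\<close>] P0
    by (simp add: lookup_minus)
  ultimately have "(mono_poly b :: 'k mpol) \<in> I"
    using mem_monomial_ideal_iff[OF mon] by (metis in_keys_iff zero_neq_one)
  then have "b = v" using minv mdvd_add_left[OF mdvd_refl] v_eq by blast
  then have "w = 0" using v_eq by simp
  show ?thesis
  proof (intro equals0I)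
    fix i assume "i \<in> Poly_Mapping.keys u \<inter> Poly_Mapping.keys v"
    then have "Poly_Mapping.lookup u i > 0" "Poly_Mapping.lookup v i > 0"
      by (auto simp: in_keys_iff)
    then have "Poly_Mapping.lookup w i > 0"
      unfolding w_def a_def by (simp add: lookup_minus)
    with \<open>w = 0\<close> show False by simp
  qed
qed

text \<open>
  Needed because \<open>ideal_deg\<close> is a maximum, which bounds the degrees of the minimal generators only
  if there are finitely many of them.
\<close>

lemma finite_coprime_monomials:
  assumes "pairwise (\<lambda>u v. Poly_Mapping.keys u \<inter> Poly_Mapping.keys v = {}) S"
    and "\<And>u. u \<in> S \<Longrightarrow> Poly_Mapping.keys u \<subseteq> {1..n}"
  shows "finite (S :: mon set)"
proof -
  have "inj_on Poly_Mapping.keys S"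
  proof (rule inj_onI, rule ccontr)
    fix u v assume uv: "u \<in> S" "v \<in> S" "Poly_Mapping.keys u = Poly_Mapping.keys v" "u \<noteq> v"
    then have "Poly_Mapping.keys u = {}" "Poly_Mapping.keys v = {}"
      using pairwiseD[OF assms(1) uv(1,2)] by auto
    then have "Poly_Mapping.lookup u i = Poly_Mapping.lookup v i" for i
      by (metis empty_iff in_keys_iff)
    with \<open>u \<noteq> v\<close> show False by (blast intro: poly_mapping_eqI)
  qed
  moreover have "Poly_Mapping.keys ` S \<subseteq> Pow {1..n}" using assms(2) by blast
  ultimately show ?thesis
    by (meson finite_Pow_iff finite_atLeastAtMost finite_imageD finite_subset)
qed

section \<open>The operator sigma on monomials\<close>

lemma lookup_sum_list_single:
  "Poly_Mapping.lookup (\<Sum>i\<leftarrow>xs. Poly_Mapping.single i (1::nat)) k = count (mset xs) k"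
  by (induction xs) (auto simp: lookup_add lookup_single when_def)

text \<open>
  A sorted list is determined by its multiset of entries, so \<open>indices\<close> can be computed by guessing
  a sorted list with the right product.
\<close>

lemma indices_unique:
  assumes "sorted xs" and "(\<Sum>i\<leftarrow>xs. Poly_Mapping.single i (1::nat)) = u"
  shows "indices u = xs"
proof -
  have "mset xs = mset (indices u)"
    unfolding multiset_eq_iff lookup_sum_list_single[symmetric] sum_indices assms(2) by simp
  then show ?thesis
    using assms(1) sorted_indices by (metis properties_for_sort)
qed

lemma set_indices: "set (indices u) = Poly_Mapping.keys u"
  by (auto simp: indices_def in_keys_iff)

lemma length_indices: "length (indices u) = mdeg u"
  by (simp add: indices_def mdeg_def length_concat comp_def sum_list_distinct_conv_sum_set)

text \<open>
  The shifted indices are again weakly increasing, so \<open>\<sigma>\<close> does not permute positions. This is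
  what makes its iterates explicit.
\<close>

lemma indices_sigma: "indices (sigma u) = map (\<lambda>j. indices u ! j + j) [0..<length (indices u)]"
proof (rule indices_unique)
  show "sorted (map (\<lambda>j. indices u ! j + j) [0..<length (indices u)])"
    using sorted_indices[of u]
    by (auto simp: sorted_iff_nth_mono intro!: add_mono)
  show "(\<Sum>i\<leftarrow>map (\<lambda>j. indices u ! j + j) [0..<length (indices u)]. Poly_Mapping.single i 1) = sigma u"
    by (simp add: sigma_def comp_def sum_list_distinct_conv_sum_set atLeast0LessThan)
qed

lemma indices_sigma_pow:
  "indices ((sigma ^^ t) u) = map (\<lambda>j. indices u ! j + j * t) [0..<length (indices u)]"
proof (induction t)
  case 0
  show ?case by (simp add: map_nth)
next
  case (Suc t)
  show ?case by (simp add: indices_sigma Suc add.commute)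
qed

lemma keys_sigma_pow:
  "Poly_Mapping.keys ((sigma ^^ t) u) = {indices u ! j + j * t | j. j < mdeg u}"
  by (auto simp: set_indices[symmetric] indices_sigma_pow length_indices)

lemma indices_nth_mem_keys: "j < mdeg u \<Longrightarrow> indices u ! j \<in> Poly_Mapping.keys u"
  by (metis length_indices nth_mem set_indices)

lemma keys_sigma_pow_subset:
  assumes "Poly_Mapping.keys u \<subseteq> {1..n}" and "n \<le> t" and "k \<le> t" and "mdeg u \<le> d"
  shows "Poly_Mapping.keys ((sigma ^^ k) u) \<subseteq> {1..t * d}"
proof
  fix x assume "x \<in> Poly_Mapping.keys ((sigma ^^ k) u)"
  then obtain j where j: "j < mdeg u" and x: "x = indices u ! j + j * k"
    by (auto simp: keys_sigma_pow)
  have i: "indices u ! j \<in> {1..n}" using indices_nth_mem_keys[OF j] assms(1) by blast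
  then have "x \<le> t + j * t" unfolding x using assms(2,3) by (intro add_mono mult_le_mono) auto
  also have "\<dots> = t * Suc j" by simp
  also have "\<dots> \<le> t * d" using j assms(4) by (intro mult_le_mono) auto
  finally show "x \<in> {1..t * d}" using i x by auto
qed

text \<open>
  With list positions counted from \<open>0\<close>, an index \<open>i \<in> {1..n}\<close> at position \<open>l\<close> moves to \<open>i + l t\<close>. For
  \<open>n \<le> t\<close> the position can be recovered as \<open>(i + l t - 1) div t\<close>, where the \<open>- 1\<close> accounts for
  \<open>i = t\<close>.
\<close>

lemma sigma_pow_coprime:
  assumes "Poly_Mapping.keys u \<subseteq> {1..n}" "Poly_Mapping.keys v \<subseteq> {1..n}" and "n \<le> t"
    and "Poly_Mapping.keys u \<inter> Poly_Mapping.keys v = {}"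
  shows "Poly_Mapping.keys ((sigma ^^ t) u) \<inter> Poly_Mapping.keys ((sigma ^^ t) v) = {}"
proof (intro equals0I)
  fix x assume "x \<in> Poly_Mapping.keys ((sigma ^^ t) u) \<inter> Poly_Mapping.keys ((sigma ^^ t) v)"
  then obtain j k where j: "j < mdeg u" and k: "k < mdeg v"
    and x: "x = indices u ! j + j * t" "x = indices v ! k + k * t"
    by (auto simp: keys_sigma_pow)
  have block: "(i + l * t - 1) div t = l" if "i \<in> {1..n}" for i l
  proof -
    have "i + l * t - 1 = (i - 1) + l * t" "i - 1 < t" using that assms(3) by auto
    then show ?thesis by simp
  qed
  have ij: "indices u ! j \<in> Poly_Mapping.keys u" and ik: "indices v ! k \<in> Poly_Mapping.keys v"
    using j k by (auto intro: indices_nth_mem_keys)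
  then have "j = k" using block[of "indices u ! j" j] block[of "indices v ! k" k] x assms(1,2)
    by (metis subsetD)
  with x have "indices u ! j = indices v ! k" by simp
  with ij ik assms(4) show False by auto
qed

section \<open>The iterated construction\<close>

text \<open>
  Only an inclusion, since \<open>\<sigma>\<close> can create divisibilities and thereby lose generators on the way.
  The bound on all intermediate \<open>\<sigma>\<^sup>j(u)\<close> keeps every stage inside the ring in which the ideals are
  formed.
\<close>

lemma mingens_sigma_ideal_iter_subset:
  fixes I :: "'k::field mpol set"
  assumes "\<And>u j. u \<in> mingens I \<Longrightarrow> j \<le> k \<Longrightarrow> Poly_Mapping.keys ((sigma ^^ j) u) \<subseteq> {1..m}"
  shows "mingens (sigma_ideal_iter m k I) \<subseteq> (sigma ^^ k) ` mingens I"
  using assms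
proof (induction k)
  case 0
  show ?case by (simp add: sigma_ideal_iter_def)
next
  case (Suc k)
  define G where "G = sigma ` mingens (sigma_ideal_iter m k I)"
  have G: "G \<subseteq> (sigma ^^ Suc k) ` mingens I"
  proof -
    have "mingens (sigma_ideal_iter m k I) \<subseteq> (sigma ^^ k) ` mingens I"
      using Suc.prems by (intro Suc.IH) (meson le_SucI)
    then show ?thesis
      unfolding G_def funpow.simps image_comp[symmetric] by (rule image_mono)
  qed
  then have "(mono_poly ` G :: 'k mpol set) \<subseteq> carrier (T m)"
    using Suc.prems[OF _ order_refl] unfolding image_subset_iff mono_poly_carrier_iff by blast
  from mingens_Idl_subset[OF this] G show ?case
    by (simp add: sigma_ideal_iter_def sigma_ideal_def G_def)
qed

theorem proposition1p2:
  fixes I :: "'k::field mpol set" and n d t :: nat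
  assumes "monomial_ideal n I"
    and "I \<noteq> {0}"
    and "complete_intersection (T n) I"
    and "ideal_deg I = d"
    and "t \<ge> n"
  shows "complete_intersection (T (t * d)) (sigma_ideal_iter (t * d) t I) \<and>
         complete_intersection (T (t * d)) (sigma_pow_ideal (t * d) t I)"
proof -
  have keys: "Poly_Mapping.keys u \<subseteq> {1..n}" if "u \<in> mingens I" for u
  proof -
    have "(mono_poly u :: 'k mpol) \<in> I" using that by (simp add: mingens_def)
    then have "(mono_poly u :: 'k mpol) \<in> carrier (T n)"
      by (rule ideal_T_carrier[OF ideal_monomial_ideal[OF assms(1)]])
    then show ?thesis by (simp only: mono_poly_carrier_iff)
  qed
  have cop: "Poly_Mapping.keys u \<inter> Poly_Mapping.keys v = {}"
    if "u \<in> mingens I" "v \<in> mingens I" "u \<noteq> v" for u v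
    using mingens_coprime[OF assms(1,3)] that by blast
  have fin: "finite (mingens I)"
    using cop keys by (intro finite_coprime_monomials) (auto simp: pairwise_def)
  then have deg: "mdeg u \<le> d" if "u \<in> mingens I" for u
    using that assms(4) by (auto simp: ideal_deg_def)
  have bound: "Poly_Mapping.keys ((sigma ^^ k) u) \<subseteq> {1..t * d}" if "u \<in> mingens I" "k \<le> t" for u k
    using keys[OF that(1)] assms(5) that(2) deg[OF that(1)] by (rule keys_sigma_pow_subset)
  define S where "S = (sigma ^^ t) ` mingens I"
  have S_cop: "pairwise (\<lambda>u v. Poly_Mapping.keys u \<inter> Poly_Mapping.keys v = {}) S"
    unfolding S_def pairwise_def
    using sigma_pow_coprime[OF keys keys assms(5) cop] by blast
  have sub: "complete_intersection (T (t * d)) (Idl\<^bsub>T (t * d)\<^esub> (mono_poly ` S') :: 'k mpol set)"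
    if "S' \<subseteq> S" for S'
  proof (rule complete_intersection_coprime_monomials)
    show "finite S'" using that fin finite_subset unfolding S_def by blast
    show "Poly_Mapping.keys u \<subseteq> {1..t * d}" if "u \<in> S'" for u
      using that \<open>S' \<subseteq> S\<close> bound[of _ t] unfolding S_def by blast
  qed (use that S_cop pairwise_subset in blast)
  have "complete_intersection (T (t * d)) (sigma_ideal_iter (t * d) t I)"
  proof (cases t)
    \<comment> \<open>Then \<open>n = 0\<close>, and the ideal is \<open>I\<close> itself, in the same ring.\<close>
    case 0
    then show ?thesis using assms(3,5) by (simp add: sigma_ideal_iter_def)
  next
    case (Suc k)
    \<comment> \<open>The last step is split off because its ideal is defined by generators that need not be
      minimal, but are still among the \<open>\<sigma>\<^sup>t(u)\<close>.\<close>
    have "sigma ` mingens (sigma_ideal_iter (t * d) k I) \<subseteq> S"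
    proof -
      have "mingens (sigma_ideal_iter (t * d) k I) \<subseteq> (sigma ^^ k) ` mingens I"
        using bound Suc by (intro mingens_sigma_ideal_iter_subset) auto
      then show ?thesis
        unfolding S_def Suc funpow.simps image_comp[symmetric] by (rule image_mono)
    qed
    from sub[OF this] show ?thesis
      by (simp add: sigma_ideal_iter_def sigma_ideal_def Suc)
  qed
  moreover have "complete_intersection (T (t * d)) (sigma_pow_ideal (t * d) t I)"
    using sub[of S] by (simp add: sigma_pow_ideal_def S_def)
  ultimately show ?thesis by blast
qed

end
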